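(* Let $\nabla$ be a torsion-free connection with symmetric projective Schouten tensor on an $n$-dimensional manifold $M$, and let $g^{ab}$ be a symmetric tensor, $\mu^a$ a vector field and $\rho$ a function on $M$. The equation $$\mathrm D\mu^b=\rho\,\theta^b-\omega_cg^{bc}-\tfrac1nW^b_{~cda}g^{cd}\theta^a$$ is compatible with the integrability condition $$\Omega^b_{~a}g^{ac}+\Omega^c_{~a}g^{ba}=\mathrm D\mu^c\wedge\theta^b+\mathrm D\mu^b\wedge\theta^c$$ (i.e. both hold) only if $g^{ab}$ satisfies the algebraic equation $$T_{[ed]}{}^{cb}{}_{af}\,g^{af}=0,$$ where $$T_{[ed]}{}^{cb}{}_{af}=\tfrac12\delta^c_{~(a}W^b_{~f)ed}+\tfrac12\delta^b_{~(a}W^c_{~f)ed}+\tfrac1nW^c_{~(af)[e}\delta^b_{~d]}+\tfrac1nW^b_{~(af)[e}\delta^c_{~d]}.$$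
   Context: $n\ge2$; $(\theta^a)$ is a local coframe dual to a frame $(X_a)$; the connection 1-forms of $\nabla$ are $\Gamma^a_{~b}=\Gamma^a_{~bc}\theta^c$ with $\nabla_{X_a}X_b=\Gamma^c_{~ba}X_c$. $\mathrm D$ is the covariant exterior differential on tensor-valued forms, e.g. $\mathrm D\mu^b=d\mu^b+\Gamma^b_{~a}\mu^a=\theta^c\nabla_c\mu^b$. Curvature: $\Omega^a_{~b}=d\Gamma^a_{~b}+\Gamma^a_{~c}\wedge\Gamma^c_{~b}=\frac12R^a_{~bcd}\theta^c\wedge\theta^d$, $R_{ab}=R^c_{~acb}$. Projective Schouten tensor: $\mathsf P_{ab}=\frac1{n-1}R_{(ab)}-\frac1{n+1}R_{[ab]}$, assumed symmetric here, and $\omega_b=\theta^a\mathsf P_{ab}$. Projective Weyl tensor: $W^a_{~bcd}=R^a_{~bcd}-\delta^a_{~c}\mathsf P_{db}+\delta^a_{~d}\mathsf P_{cb}+2\delta^a_{~b}\mathsf P_{[cd]}$. Round (square) brackets on indices denote symmetrization (antisymmetrization) over the two enclosed indices with factor $\frac12$; in $W^c_{~(af)[e}\delta^b_{~d]}$ one symmetrizes in $a,f$ and antisymmetrizes in $e,d$. *)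

theory Defs
  imports "HOL-Analysis.Analysis"
begin

section \<open>Smooth manifolds\<close>

primrec Ck_on :: "nat \<Rightarrow> 'a::euclidean_space set \<Rightarrow> ('a \<Rightarrow> 'b::real_normed_vector) \<Rightarrow> bool" where
  "Ck_on 0 S f \<longleftrightarrow> continuous_on S f"
| "Ck_on (Suc k) S f \<longleftrightarrow> f differentiable_on S \<and>
     (\<forall>e\<in>Basis. Ck_on k S (\<lambda>x. frechet_derivative f (at x) e))"

text \<open>Only used for open \<open>S\<close>.\<close>

definition smooth_map_on :: "'a::euclidean_space set \<Rightarrow> ('a \<Rightarrow> 'b::real_normed_vector) \<Rightarrow> bool" where
  "smooth_map_on S f \<longleftrightarrow> (\<forall>k. Ck_on k S f)"

text \<open>A chart is a pair of its domain and its coordinate map (whose values off the domain are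
  irrelevant). The dimension of the manifold is \<open>CARD('n)\<close>.\<close>

record ('m, 'n) manifold_data =
  mtop :: "'m topology"
  atlas :: "('m set \<times> ('m \<Rightarrow> real ^ 'n)) set"

definition smooth_manifold :: "('m, 'n::finite) manifold_data \<Rightarrow> bool" where
  "smooth_manifold M \<longleftrightarrow>
     Hausdorff_space (mtop M) \<and> second_countable (mtop M) \<and>
     topspace (mtop M) = \<Union> (fst ` atlas M) \<and>
     (\<forall>(V, \<phi>) \<in> atlas M. openin (mtop M) V \<and> open (\<phi> ` V) \<and>
        homeomorphic_map (subtopology (mtop M) V) (top_of_set (\<phi> ` V)) \<phi>) \<and>
     (\<forall>(V, \<phi>) \<in> atlas M. \<forall>(V', \<phi>') \<in> atlas M.
        smooth_map_on (\<phi> ` (V \<inter> V')) (\<phi>' \<circ> inv_into V \<phi>))"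

definition smooth_fun_on :: "('m, 'n::finite) manifold_data \<Rightarrow> 'm set \<Rightarrow> ('m \<Rightarrow> real) \<Rightarrow> bool" where
  "smooth_fun_on M U f \<longleftrightarrow> openin (mtop M) U \<and>
     (\<forall>(V, \<phi>) \<in> atlas M. smooth_map_on (\<phi> ` (U \<inter> V)) (f \<circ> inv_into V \<phi>))"

definition smooth_near :: "('m, 'n::finite) manifold_data \<Rightarrow> 'm \<Rightarrow> ('m \<Rightarrow> real) \<Rightarrow> bool" where
  "smooth_near M p f \<longleftrightarrow> (\<exists>U. p \<in> U \<and> smooth_fun_on M U f)"

section \<open>Tangent vectors, vector fields and forms\<close>

text \<open>Tangent vectors at \<open>p\<close> are the derivations at \<open>p\<close> of the algebra of functions smooth near
  \<open>p\<close>, normalised to vanish on all other functions, so that equality of tangent vectors is equality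
  of HOL functions. Such a derivation depends only on the germ at \<open>p\<close>: the indicator function of a
  neighbourhood of \<open>p\<close> is smooth near \<open>p\<close>, and the Leibniz rule applies to it.\<close>

type_synonym 'm tvec = "('m \<Rightarrow> real) \<Rightarrow> real"
type_synonym 'm vfield = "'m \<Rightarrow> 'm tvec"
type_synonym 'm covec = "'m tvec \<Rightarrow> real"
type_synonym 'm oneform = "'m \<Rightarrow> 'm covec"
type_synonym 'm twoform = "'m vfield \<Rightarrow> 'm vfield \<Rightarrow> 'm \<Rightarrow> real"

definition tangent_space :: "('m, 'n::finite) manifold_data \<Rightarrow> 'm \<Rightarrow> 'm tvec set" where
  "tangent_space M p = {v.
     (\<forall>f g c. smooth_near M p f \<longrightarrow> smooth_near M p g \<longrightarrow>
        v (\<lambda>q. c * f q + g q) = c * v f + v g \<and>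
        v (\<lambda>q. f q * g q) = f p * v g + g p * v f) \<and>
     (\<forall>f. \<not> smooth_near M p f \<longrightarrow> v f = 0)}"

definition vector_field_on :: "('m, 'n::finite) manifold_data \<Rightarrow> 'm set \<Rightarrow> 'm vfield \<Rightarrow> bool" where
  "vector_field_on M U X \<longleftrightarrow> openin (mtop M) U \<and> (\<forall>p\<in>U. X p \<in> tangent_space M p) \<and>
     (\<forall>V f. V \<subseteq> U \<longrightarrow> smooth_fun_on M V f \<longrightarrow> smooth_fun_on M V (\<lambda>p. X p f))"

definition lie_bracket :: "('m, 'n::finite) manifold_data \<Rightarrow> 'm vfield \<Rightarrow> 'm vfield \<Rightarrow> 'm vfield" where
  "lie_bracket M X Y p = (\<lambda>f. if smooth_near M p f
     then X p (\<lambda>q. Y q f) - Y p (\<lambda>q. X q f) else 0)"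

definition cotangent_space :: "('m, 'n::finite) manifold_data \<Rightarrow> 'm \<Rightarrow> 'm covec set" where
  "cotangent_space M p = {\<alpha>.
     (\<forall>v\<in>tangent_space M p. \<forall>w\<in>tangent_space M p. \<forall>c.
        \<alpha> (\<lambda>f. c * v f + w f) = c * \<alpha> v + \<alpha> w) \<and>
     (\<forall>v. v \<notin> tangent_space M p \<longrightarrow> \<alpha> v = 0)}"

definition one_form_on :: "('m, 'n::finite) manifold_data \<Rightarrow> 'm set \<Rightarrow> 'm oneform \<Rightarrow> bool" where
  "one_form_on M U \<alpha> \<longleftrightarrow> openin (mtop M) U \<and> (\<forall>p\<in>U. \<alpha> p \<in> cotangent_space M p) \<and>
     (\<forall>V Y. V \<subseteq> U \<longrightarrow> vector_field_on M V Y \<longrightarrow> smooth_fun_on M V (\<lambda>p. \<alpha> p (Y p)))"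

text \<open>A contravariant symmetric 2-tensor field on \<open>M\<close>, as a field of symmetric bilinear forms on
  the cotangent spaces.\<close>

definition symmetric_tensor ::
    "('m, 'n::finite) manifold_data \<Rightarrow> ('m \<Rightarrow> 'm covec \<Rightarrow> 'm covec \<Rightarrow> real) \<Rightarrow> bool" where
  "symmetric_tensor M g \<longleftrightarrow>
     (\<forall>p\<in>topspace (mtop M). \<forall>\<alpha>\<in>cotangent_space M p. \<forall>\<beta>\<in>cotangent_space M p.
        g p \<alpha> \<beta> = g p \<beta> \<alpha> \<and>
        (\<forall>\<gamma>\<in>cotangent_space M p. \<forall>c. g p (\<lambda>v. c * \<alpha> v + \<beta> v) \<gamma> = c * g p \<alpha> \<gamma> + g p \<beta> \<gamma>)) \<and>
     (\<forall>V \<alpha> \<beta>. one_form_on M V \<alpha> \<longrightarrow> one_form_on M V \<beta> \<longrightarrow> smooth_fun_on M V (\<lambda>p. g p (\<alpha> p) (\<beta> p)))"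

text \<open>Wedge product and exterior derivative are normalised without numerical factors, so that
  the coefficients \<open>F\<^sub>c\<^sub>d\<close> (antisymmetric) in \<open>F = (1/2) F\<^sub>c\<^sub>d \<theta>\<^sup>c \<and> \<theta>\<^sup>d\<close> are \<open>F(X\<^sub>c, X\<^sub>d)\<close>.\<close>

definition wedge :: "'m oneform \<Rightarrow> 'm oneform \<Rightarrow> 'm twoform" where
  "wedge \<alpha> \<beta> Y Z p = \<alpha> p (Y p) * \<beta> p (Z p) - \<alpha> p (Z p) * \<beta> p (Y p)"

definition ext_deriv0 :: "('m \<Rightarrow> real) \<Rightarrow> 'm oneform" where
  "ext_deriv0 f p v = v f"

definition ext_deriv1 :: "('m, 'n::finite) manifold_data \<Rightarrow> 'm oneform \<Rightarrow> 'm twoform" where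
  "ext_deriv1 M \<alpha> Y Z p =
     Y p (\<lambda>q. \<alpha> q (Z q)) - Z p (\<lambda>q. \<alpha> q (Y q)) - \<alpha> p (lie_bracket M Y Z p)"

definition local_frame ::
    "('m, 'n::finite) manifold_data \<Rightarrow> 'm set \<Rightarrow> ('n \<Rightarrow> 'm vfield) \<Rightarrow> bool" where
  "local_frame M U X \<longleftrightarrow> (\<forall>a. vector_field_on M U (X a)) \<and>
     (\<forall>p\<in>U. \<forall>v\<in>tangent_space M p. \<exists>!c. v = (\<lambda>f. \<Sum>a\<in>UNIV. c a * X a p f))"

definition dual_coframe ::
    "('m, 'n::finite) manifold_data \<Rightarrow> 'm set \<Rightarrow> ('n \<Rightarrow> 'm vfield) \<Rightarrow> ('n \<Rightarrow> 'm oneform) \<Rightarrow> bool" where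
  "dual_coframe M U X \<theta> \<longleftrightarrow> (\<forall>a. one_form_on M U (\<theta> a)) \<and>
     (\<forall>p\<in>U. \<forall>a b. \<theta> a p (X b p) = (if a = b then 1 else 0))"

section \<open>Affine connections\<close>

text \<open>One function \<open>nab\<close> subject to the axioms on every open set is the same as a connection on the
  sheaf of vector fields. Locality (\<open>nab X Y p\<close> depends only on \<open>X\<close> and \<open>Y\<close> near \<open>p\<close>) follows as for
  tangent vectors, by multiplying with the indicator function of a neighbourhood.\<close>

definition affine_connection ::
    "('m, 'n::finite) manifold_data \<Rightarrow> ('m vfield \<Rightarrow> 'm vfield \<Rightarrow> 'm vfield) \<Rightarrow> bool" where
  "affine_connection M nab \<longleftrightarrow>
     (\<forall>U X Y Z h. vector_field_on M U X \<longrightarrow> vector_field_on M U Y \<longrightarrow> vector_field_on M U Z \<longrightarrow>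
        smooth_fun_on M U h \<longrightarrow>
        vector_field_on M U (nab X Y) \<and>
        (\<forall>p\<in>U.
           nab (\<lambda>q f. X q f + Y q f) Z p = (\<lambda>f. nab X Z p f + nab Y Z p f) \<and>
           nab (\<lambda>q f. h q * X q f) Z p = (\<lambda>f. h p * nab X Z p f) \<and>
           nab X (\<lambda>q f. Y q f + Z q f) p = (\<lambda>f. nab X Y p f + nab X Z p f) \<and>
           nab X (\<lambda>q f. h q * Y q f) p = (\<lambda>f. X p h * Y p f + h p * nab X Y p f)))"

definition torsion_free ::
    "('m, 'n::finite) manifold_data \<Rightarrow> ('m vfield \<Rightarrow> 'm vfield \<Rightarrow> 'm vfield) \<Rightarrow> bool" where
  "torsion_free M nab \<longleftrightarrow>
     (\<forall>U X Y. vector_field_on M U X \<longrightarrow> vector_field_on M U Y \<longrightarrow>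
        (\<forall>p\<in>U. (\<lambda>f. nab X Y p f - nab Y X p f) = lie_bracket M X Y p))"

section \<open>Components with respect to a frame \<open>X\<close> and its dual coframe \<open>\<theta>\<close>\<close>

text \<open>\<open>christoffel nab X \<theta> a b c\<close> is \<open>\<Gamma>\<^sup>a\<^sub>b\<^sub>c\<close>, where \<open>\<nabla>\<^bsub>X\<^sub>c\<^esub> X\<^sub>b = \<Gamma>\<^sup>a\<^sub>b\<^sub>c X\<^sub>a\<close>: the direction of
  differentiation is the last index. In all tensors below the arguments are the indices of the
  tensor from left to right, upper index first.\<close>

definition christoffel :: "('m vfield \<Rightarrow> 'm vfield \<Rightarrow> 'm vfield) \<Rightarrow> ('n::finite \<Rightarrow> 'm vfield) \<Rightarrow>
    ('n \<Rightarrow> 'm oneform) \<Rightarrow> 'n \<Rightarrow> 'n \<Rightarrow> 'n \<Rightarrow> 'm \<Rightarrow> real" where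
  "christoffel nab X \<theta> a b c p = \<theta> a p (nab (X c) (X b) p)"

definition connection_form :: "('m vfield \<Rightarrow> 'm vfield \<Rightarrow> 'm vfield) \<Rightarrow> ('n::finite \<Rightarrow> 'm vfield) \<Rightarrow>
    ('n \<Rightarrow> 'm oneform) \<Rightarrow> 'n \<Rightarrow> 'n \<Rightarrow> 'm oneform" where
  "connection_form nab X \<theta> a b p v = (\<Sum>c\<in>UNIV. christoffel nab X \<theta> a b c p * \<theta> c p v)"

definition vcomp :: "('n::finite \<Rightarrow> 'm oneform) \<Rightarrow> 'm vfield \<Rightarrow> 'n \<Rightarrow> 'm \<Rightarrow> real" where
  "vcomp \<theta> \<mu> a p = \<theta> a p (\<mu> p)"

definition tcomp :: "('n::finite \<Rightarrow> 'm oneform) \<Rightarrow> ('m \<Rightarrow> 'm covec \<Rightarrow> 'm covec \<Rightarrow> real) \<Rightarrow>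
    'n \<Rightarrow> 'n \<Rightarrow> 'm \<Rightarrow> real" where
  "tcomp \<theta> g a b p = g p (\<theta> a p) (\<theta> b p)"

definition cov_ext_deriv :: "('m vfield \<Rightarrow> 'm vfield \<Rightarrow> 'm vfield) \<Rightarrow> ('n::finite \<Rightarrow> 'm vfield) \<Rightarrow>
    ('n \<Rightarrow> 'm oneform) \<Rightarrow> 'm vfield \<Rightarrow> 'n \<Rightarrow> 'm oneform" where
  "cov_ext_deriv nab X \<theta> \<mu> b p v = ext_deriv0 (vcomp \<theta> \<mu> b) p v +
     (\<Sum>a\<in>UNIV. connection_form nab X \<theta> b a p v * vcomp \<theta> \<mu> a p)"

definition curvature_form :: "('m, 'n::finite) manifold_data \<Rightarrow> ('m vfield \<Rightarrow> 'm vfield \<Rightarrow> 'm vfield) \<Rightarrow>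
    ('n \<Rightarrow> 'm vfield) \<Rightarrow> ('n \<Rightarrow> 'm oneform) \<Rightarrow> 'n \<Rightarrow> 'n \<Rightarrow> 'm twoform" where
  "curvature_form M nab X \<theta> a b Y Z p = ext_deriv1 M (connection_form nab X \<theta> a b) Y Z p +
     (\<Sum>c\<in>UNIV. wedge (connection_form nab X \<theta> a c) (connection_form nab X \<theta> c b) Y Z p)"

definition curvature :: "('m, 'n::finite) manifold_data \<Rightarrow> ('m vfield \<Rightarrow> 'm vfield \<Rightarrow> 'm vfield) \<Rightarrow>
    ('n \<Rightarrow> 'm vfield) \<Rightarrow> ('n \<Rightarrow> 'm oneform) \<Rightarrow> 'n \<Rightarrow> 'n \<Rightarrow> 'n \<Rightarrow> 'n \<Rightarrow> 'm \<Rightarrow> real" where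
  "curvature M nab X \<theta> a b c d p = curvature_form M nab X \<theta> a b (X c) (X d) p"

definition ricci :: "('m, 'n::finite) manifold_data \<Rightarrow> ('m vfield \<Rightarrow> 'm vfield \<Rightarrow> 'm vfield) \<Rightarrow>
    ('n \<Rightarrow> 'm vfield) \<Rightarrow> ('n \<Rightarrow> 'm oneform) \<Rightarrow> 'n \<Rightarrow> 'n \<Rightarrow> 'm \<Rightarrow> real" where
  "ricci M nab X \<theta> a b p = (\<Sum>c\<in>UNIV. curvature M nab X \<theta> c a c b p)"

definition symm :: "('n \<Rightarrow> 'n \<Rightarrow> real) \<Rightarrow> 'n \<Rightarrow> 'n \<Rightarrow> real" where
  "symm F a b = (F a b + F b a) / 2"

definition alt :: "('n \<Rightarrow> 'n \<Rightarrow> real) \<Rightarrow> 'n \<Rightarrow> 'n \<Rightarrow> real" where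
  "alt F a b = (F a b - F b a) / 2"

definition kdelta :: "'n \<Rightarrow> 'n \<Rightarrow> real" where
  "kdelta a b = (if a = b then 1 else 0)"

definition schouten :: "('m, 'n::finite) manifold_data \<Rightarrow> ('m vfield \<Rightarrow> 'm vfield \<Rightarrow> 'm vfield) \<Rightarrow>
    ('n \<Rightarrow> 'm vfield) \<Rightarrow> ('n \<Rightarrow> 'm oneform) \<Rightarrow> 'n \<Rightarrow> 'n \<Rightarrow> 'm \<Rightarrow> real" where
  "schouten M nab X \<theta> a b p =
     1 / (real CARD('n) - 1) * symm (\<lambda>a b. ricci M nab X \<theta> a b p) a b -
     1 / (real CARD('n) + 1) * alt (\<lambda>a b. ricci M nab X \<theta> a b p) a b"

definition schouten_form :: "('m, 'n::finite) manifold_data \<Rightarrow> ('m vfield \<Rightarrow> 'm vfield \<Rightarrow> 'm vfield) \<Rightarrow>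
    ('n \<Rightarrow> 'm vfield) \<Rightarrow> ('n \<Rightarrow> 'm oneform) \<Rightarrow> 'n \<Rightarrow> 'm oneform" where
  "schouten_form M nab X \<theta> b p v = (\<Sum>a\<in>UNIV. \<theta> a p v * schouten M nab X \<theta> a b p)"

definition weyl :: "('m, 'n::finite) manifold_data \<Rightarrow> ('m vfield \<Rightarrow> 'm vfield \<Rightarrow> 'm vfield) \<Rightarrow>
    ('n \<Rightarrow> 'm vfield) \<Rightarrow> ('n \<Rightarrow> 'm oneform) \<Rightarrow> 'n \<Rightarrow> 'n \<Rightarrow> 'n \<Rightarrow> 'n \<Rightarrow> 'm \<Rightarrow> real" where
  "weyl M nab X \<theta> a b c d p = curvature M nab X \<theta> a b c d p
     - kdelta a c * schouten M nab X \<theta> d b p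
     + kdelta a d * schouten M nab X \<theta> c b p
     + 2 * kdelta a b * alt (\<lambda>c d. schouten M nab X \<theta> c d p) c d"

text \<open>\<open>obstruction M nab X \<theta> e d c b a f\<close> is \<open>T\<^bsub>[ed]\<^esub>\<^bsup>cb\<^esup>\<^bsub>af\<^esub>\<close>.\<close>

definition obstruction :: "('m, 'n::finite) manifold_data \<Rightarrow> ('m vfield \<Rightarrow> 'm vfield \<Rightarrow> 'm vfield) \<Rightarrow>
    ('n \<Rightarrow> 'm vfield) \<Rightarrow> ('n \<Rightarrow> 'm oneform) \<Rightarrow> 'n \<Rightarrow> 'n \<Rightarrow> 'n \<Rightarrow> 'n \<Rightarrow> 'n \<Rightarrow> 'n \<Rightarrow> 'm \<Rightarrow> real" where
  "obstruction M nab X \<theta> e d c b a f p =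
     (let W = (\<lambda>a b c d. weyl M nab X \<theta> a b c d p); n = real CARD('n) in
        1 / 2 * symm (\<lambda>a f. kdelta c a * W b f e d) a f
      + 1 / 2 * symm (\<lambda>a f. kdelta b a * W c f e d) a f
      + 1 / n * alt (\<lambda>e d. symm (\<lambda>a f. W c a f e) a f * kdelta b d) e d
      + 1 / n * alt (\<lambda>e d. symm (\<lambda>a f. W b a f e) a f * kdelta c d) e d)"

end

theory Submission
  imports Defs
begin

text \<open>The integrability condition, evaluated on pairs of frame vectors, is an algebraic identity at
  each point. Insert the equation for \<open>D\<mu>\<close> and split the curvature into the Weyl tensor and the
  Schouten tensor: the terms in \<open>\<rho>\<close> cancel by the skew-symmetry of the wedge product, the Schouten
  terms agree on both sides, and the remaining Weyl terms are twice the contraction of the obstruction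
  with \<open>g\<close>.\<close>

lemma sum_kdelta:
  "(\<Sum>a\<in>UNIV. kdelta (c::'n::finite) a * F a) = F c"
proof -
  have "(\<Sum>a\<in>UNIV. kdelta c a * F a) = (\<Sum>a\<in>UNIV. if c = a then F a else 0)"
    by (intro sum.cong) (auto simp: kdelta_def)
  then show ?thesis by simp
qed

text \<open>Interchanging the two summations and using the symmetry of \<open>G\<close> shows that
  both halves of \<open>symm F\<close> contribute equally, so a symmetric \<open>G\<close> absorbs
  the symmetrization.\<close>

lemma sum_symm_contract:
  fixes F G :: "'n::finite \<Rightarrow> 'n \<Rightarrow> real"
  assumes "\<And>a f. G a f = G f a"
  shows "(\<Sum>a\<in>UNIV. \<Sum>f\<in>UNIV. symm F a f * G a f) = (\<Sum>a\<in>UNIV. \<Sum>f\<in>UNIV. F a f * G a f)"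
proof -
  have "(\<Sum>a\<in>UNIV. \<Sum>f\<in>UNIV. F f a * G a f) = (\<Sum>f\<in>UNIV. \<Sum>a\<in>UNIV. F f a * G f a)"
    by (subst sum.swap) (simp add: assms)
  then show ?thesis
    by (simp add: symm_def distrib_right add_divide_distrib sum.distrib flip: sum_divide_distrib)
qed

text \<open>Each symmetrization in \<open>a\<close>, \<open>f\<close> is absorbed by the symmetric
  \<open>G\<close>, and each delta carrying a summation index collapses one sum. The
  antisymmetrization in \<open>e\<close>, \<open>d\<close> stays and is written out; its factor 1/2
  turns 1/n into 1/(2n).\<close>

lemma obstruction_contract:
  fixes M :: "('m, 'n::finite) manifold_data" and nab and X and \<theta> and G :: "'n \<Rightarrow> 'n \<Rightarrow> real"
  assumes "\<And>a f. G a f = G f a"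
  defines "W \<equiv> \<lambda>a b c d p. weyl M nab X \<theta> a b c d p"
    and "n \<equiv> real CARD('n)"
  shows "(\<Sum>a\<in>UNIV. \<Sum>f\<in>UNIV. obstruction M nab X \<theta> e d c b a f p * G a f) =
      1/2 * ((\<Sum>a\<in>UNIV. W b a e d p * G a c) + (\<Sum>a\<in>UNIV. W c a e d p * G b a))
    + 1/(2*n) * ((\<Sum>a\<in>UNIV. \<Sum>f\<in>UNIV. W c a f e p * G a f) * kdelta b d
               - (\<Sum>a\<in>UNIV. \<Sum>f\<in>UNIV. W c a f d p * G a f) * kdelta b e
               + (\<Sum>a\<in>UNIV. \<Sum>f\<in>UNIV. W b a f e p * G a f) * kdelta c d
               - (\<Sum>a\<in>UNIV. \<Sum>f\<in>UNIV. W b a f d p * G a f) * kdelta c e)"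
proof -
  \<comment> \<open>Naming the symmetrized contraction lets the obstruction be expanded by linearity
    alone; \<open>S\<close> and \<open>D\<close> then evaluate the resulting terms.\<close>
  define S where "S = (\<lambda>F. \<Sum>a\<in>UNIV. \<Sum>f\<in>UNIV. symm F a f * G a f)"
  have S: "S F = (\<Sum>a\<in>UNIV. \<Sum>f\<in>UNIV. F a f * G a f)" for F
    unfolding S_def by (rule sum_symm_contract) (rule assms(1))
  have D: "S (\<lambda>a f. kdelta c a * V f) = (\<Sum>f\<in>UNIV. V f * G c f)" for c V
    unfolding S by (simp add: mult.assoc sum_kdelta flip: sum_distrib_left)
  have "(\<Sum>a\<in>UNIV. \<Sum>f\<in>UNIV. obstruction M nab X \<theta> e d c b a f p * G a f) =
      1/2 * S (\<lambda>a f. kdelta c a * W b f e d p) + 1/2 * S (\<lambda>a f. kdelta b a * W c f e d p)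
    + 1/(2*n) * (S (\<lambda>a f. W c a f e p) * kdelta b d - S (\<lambda>a f. W c a f d p) * kdelta b e
               + S (\<lambda>a f. W b a f e p) * kdelta c d - S (\<lambda>a f. W b a f d p) * kdelta c e)"
    unfolding S_def obstruction_def Let_def alt_def W_def [symmetric] n_def [symmetric]
    by (simp add: sum_distrib_left sum_distrib_right flip: sum.distrib sum_subtractf)
       (intro sum.cong refl, simp add: algebra_simps add_divide_distrib diff_divide_distrib)
  then show ?thesis
    unfolding D S by (simp add: assms(1) distrib_left)
qed

theorem proposition2p11:
  fixes M :: "('m, 'n::finite) manifold_data"
    and nab :: "'m vfield \<Rightarrow> 'm vfield \<Rightarrow> 'm vfield"
    and U :: "'m set"
    and X :: "'n \<Rightarrow> 'm vfield"
    and \<theta> :: "'n \<Rightarrow> 'm oneform"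
    and g :: "'m \<Rightarrow> 'm covec \<Rightarrow> 'm covec \<Rightarrow> real"
    and \<mu> :: "'m vfield"
    and \<rho> :: "'m \<Rightarrow> real"
  assumes dim: "CARD('n) \<ge> 2"
    and manifold: "smooth_manifold M"
    and connection: "affine_connection M nab" "torsion_free M nab"
    and frame: "local_frame M U X" "dual_coframe M U X \<theta>"
    and schouten_sym: "\<forall>p\<in>U. \<forall>a b. schouten M nab X \<theta> a b p = schouten M nab X \<theta> b a p"
    and g: "symmetric_tensor M g"
    and \<mu>: "vector_field_on M (topspace (mtop M)) \<mu>"
    and \<rho>: "smooth_fun_on M (topspace (mtop M)) \<rho>"
    and equation: "\<forall>p\<in>U. \<forall>v\<in>tangent_space M p. \<forall>b.
      cov_ext_deriv nab X \<theta> \<mu> b p v =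
        \<rho> p * \<theta> b p v
        - (\<Sum>c\<in>UNIV. schouten_form M nab X \<theta> c p v * tcomp \<theta> g b c p)
        - 1 / real CARD('n) *
          (\<Sum>a\<in>UNIV. \<Sum>c\<in>UNIV. \<Sum>d\<in>UNIV. weyl M nab X \<theta> b c d a p * tcomp \<theta> g c d p * \<theta> a p v)"
    and integrability: "\<forall>Y Z. vector_field_on M U Y \<longrightarrow> vector_field_on M U Z \<longrightarrow> (\<forall>p\<in>U. \<forall>b c.
      (\<Sum>a\<in>UNIV. curvature_form M nab X \<theta> b a Y Z p * tcomp \<theta> g a c p)
      + (\<Sum>a\<in>UNIV. curvature_form M nab X \<theta> c a Y Z p * tcomp \<theta> g b a p) =
        wedge (cov_ext_deriv nab X \<theta> \<mu> c) (\<theta> b) Y Z p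
        + wedge (cov_ext_deriv nab X \<theta> \<mu> b) (\<theta> c) Y Z p)"
  shows "\<forall>p\<in>U. \<forall>e d c b.
    (\<Sum>a\<in>UNIV. \<Sum>f\<in>UNIV. obstruction M nab X \<theta> e d c b a f p * tcomp \<theta> g a f p) = 0"
proof (intro ballI allI)
  fix p e d c b assume p: "p \<in> U"
  define G where "G = (\<lambda>a b. tcomp \<theta> g a b p)"
  define W where "W = (\<lambda>a b c d. weyl M nab X \<theta> a b c d p)"
  define P where "P = (\<lambda>a b. schouten M nab X \<theta> a b p)"
  define R where "R = (\<lambda>a b c d. curvature M nab X \<theta> a b c d p)"
  define n where "n = real CARD('n)"
  \<comment> \<open>\<open>A b e\<close> and \<open>B b e\<close> are the values on
    \<open>X e\<close> of the one-forms \<omega>_c g^{bc} and W^b_{cda} g^{cd} \<theta>^a in the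
    equation for D\<mu>^b.\<close>
  define A where "A = (\<lambda>b e. \<Sum>a\<in>UNIV. P e a * G b a)"
  define B where "B = (\<lambda>b e. \<Sum>a\<in>UNIV. \<Sum>f\<in>UNIV. W b a f e * G a f)"
  have X: "vector_field_on M U (X a)" for a
    using frame(1) by (simp add: local_frame_def)
  have tangent: "X a p \<in> tangent_space M p" for a
    using X p by (auto simp: vector_field_on_def)
  have dual: "\<theta> a p (X b p) = kdelta a b" for a b
    using frame(2) p by (simp add: dual_coframe_def kdelta_def)
  \<comment> \<open>The symmetry of \<open>g\<close> is given only for covectors at points of the
    manifold, so both memberships must be established first.\<close>
  have "\<theta> a p \<in> cotangent_space M p" for a
    using frame(2) p by (auto simp: dual_coframe_def one_form_on_def)
  moreover have "p \<in> topspace (mtop M)"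
    using X p openin_subset by (fastforce simp: vector_field_on_def)
  ultimately have Gsym: "G a f = G f a" for a f
    using g by (auto simp: G_def tcomp_def symmetric_tensor_def)
  \<comment> \<open>The antisymmetric part of the Schouten tensor in the definition of
    \<open>weyl\<close> vanishes by \<open>schouten_sym\<close>.\<close>
  have R: "R b a e d = W b a e d + kdelta b e * P d a - kdelta b d * P e a" for a b d e
    using schouten_sym p by (simp add: R_def W_def P_def weyl_def alt_def)
  \<comment> \<open>This is \<open>equation\<close> at the tangent vector \<open>X e\<close>.
    Duality produces \<open>kdelta a e\<close>, and \<open>kd\<close> flips it so that
    \<open>sum_kdelta\<close> can collapse the sum over \<open>a\<close>.\<close>
  have D\<mu>: "cov_ext_deriv nab X \<theta> \<mu> b p (X e p) = \<rho> p * kdelta b e - A b e - 1 / n * B b e" for b e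
  proof -
    have kd: "kdelta a e = kdelta e a" for a :: 'n
      by (auto simp: kdelta_def)
    have "schouten_form M nab X \<theta> c p (X e p) = P e c" for c
      unfolding schouten_form_def dual P_def kd by (rule sum_kdelta)
    moreover have "(\<Sum>a\<in>UNIV. \<Sum>c\<in>UNIV. \<Sum>d\<in>UNIV. W b c d a * G c d * kdelta a e) = B b e"
      by (simp add: B_def kd sum_kdelta mult.commute[of _ "kdelta e _"] flip: sum_distrib_left)
    ultimately show ?thesis
      using equation p tangent by (simp add: dual A_def G_def W_def n_def)
  qed
  have contract: "(\<Sum>a\<in>UNIV. R b a e d * G c a) =
      (\<Sum>a\<in>UNIV. W b a e d * G c a) + kdelta b e * A c d - kdelta b d * A c e" for b c
    by (simp add: R A_def algebra_simps sum.distrib sum_subtractf sum_distrib_left)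
  have "(\<Sum>a\<in>UNIV. R b a e d * G a c) + (\<Sum>a\<in>UNIV. R c a e d * G b a) =
      wedge (cov_ext_deriv nab X \<theta> \<mu> c) (\<theta> b) (X e) (X d) p
    + wedge (cov_ext_deriv nab X \<theta> \<mu> b) (\<theta> c) (X e) (X d) p"
    unfolding R_def G_def curvature_def using integrability X p by blast
  \<comment> \<open>\<open>Gsym\<close> brings the first sum into the form required by
    \<open>contract\<close>. The \<rho> terms cancel only between the two wedge products, which are
    exchanged by swapping \<open>b\<close> and \<open>c\<close>; the \<open>A\<close> terms coincide
    on the two sides.\<close>
  then have "(\<Sum>a\<in>UNIV. W b a e d * G c a) + (\<Sum>a\<in>UNIV. W c a e d * G b a)
    = - (1 / n) * (B c e * kdelta b d - B c d * kdelta b e + B b e * kdelta c d - B b d * kdelta c e)"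
    unfolding Gsym[of _ c] contract wedge_def dual D\<mu> by (simp add: algebra_simps)
  \<comment> \<open>Halving, with everything on one side, gives exactly the right-hand side of
    \<open>obstruction_contract\<close>.\<close>
  then have "1/2 * ((\<Sum>a\<in>UNIV. W b a e d * G a c) + (\<Sum>a\<in>UNIV. W c a e d * G b a))
    + 1/(2*n) * (B c e * kdelta b d - B c d * kdelta b e + B b e * kdelta c d - B b d * kdelta c e) = 0"
    unfolding Gsym[of _ c] by (simp add: field_simps)
  then show "(\<Sum>a\<in>UNIV. \<Sum>f\<in>UNIV. obstruction M nab X \<theta> e d c b a f p * tcomp \<theta> g a f p) = 0"
    using obstruction_contract[of G M nab X \<theta> e d c b p, OF Gsym]
    unfolding B_def W_def G_def n_def by simp
qed

end
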